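(* Let $\{x^v_i\}, \{y^e_{ij}\}$ denote an optimal solution to the linear programming relaxation of OffsetRMAS. Let $\ell$ be a randomized labeling obtained by independently assigning labels to each vertex $v$ with probabilities $\Pr[\ell(v)=i] = \frac14 + \frac{x^v_i}{2}$ if $i\in\{\ell^v_{min},\ell^v_{max}\}$, and $\Pr[\ell(v)=i]=\frac{x^v_i}{2}$ if $i\in S_v\setminus\{\ell^v_{min},\ell^v_{max}\}$. Then, for any edge $e=(u,v)$, \[\Pr[ \ell(u)+o_e \leq \ell(v)] \geq \frac{1}{4}\left(1 + \frac{1}{\sqrt{2}} \right) \left(\sum_{\substack{i\in S_u, j\in S_v\\ i+o_e \leq j}}y^e_{ij}\right).\]
   Context: OffsetRMAS: digraph $D=(V,A)$, finite label sets $S_v\subseteq\mathbb{Z}^+$, non-negative edge weights, offsets $o_e\in\mathbb{Z}^+$; a labeling $\ell$ with $\ell(v)\in S_v$ satisfies $e=(u,v)$ if $\ell(u)+o_e\le\ell(v)$. Let $\ell^v_{min}=\min(S_v)$ and $\ell^v_{max}=\max(S_v)$; assume w.l.o.g. $\min(S_u)+o_e\le\max(S_v)$ for each edge. Let $\mathcal{S}=\cup_v S_v$. The LP relaxation has variables $x^v_i\ge0$ ($v\in V$, $i\in\mathcal{S}$) with $x^v_i=0$ for $i\notin S_v$ and $\sum_i x^v_i=1$, and $y^e_{ij}\ge 0$ for $e=(u,v)$, $i,j\in\mathcal{S}$, with $\sum_j y^e_{ij}=x^u_i$, $\sum_i y^e_{ij}=x^v_j$; the objective is $\sum_e w(e)\sum_{i\in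 S_u,j\in S_v,i+o_e\le j} y^e_{ij}$.
   Formalization: The digraph is taken to be loop-free (the bound fails for a loop, which is never satisfied but can have positive LP value), and a vertex with only one label receives it with probability 1, where the stated formula would give total mass 3/4. *)

theory Defs
  imports "HOL-Probability.Probability" "Graph_Theory.Pair_Digraph"
begin

text \<open>
  Digraphs are finite and loop-free, as usual; antiparallel arcs are allowed.  Loops have to be
  excluded: a loop is satisfied by no labeling, yet the LP may give it positive value
  (for a loop with offset 1 at a vertex with labels 1 and 5, put \<open>x\<close> = 1/2 on both labels and
  \<open>y\<close> = 1/2 on the pairs (1,5) and (5,1)).
\<close>

locale offset_rmas = pair_digraph D
  for D :: "'v pair_pre_digraph" +
  fixes S :: "'v \<Rightarrow> nat set"
    and w :: "'v \<times> 'v \<Rightarrow> real"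
    and off :: "'v \<times> 'v \<Rightarrow> nat"
  assumes finite_labels: "v \<in> pverts D \<Longrightarrow> finite (S v)"
    and labels_nonempty: "v \<in> pverts D \<Longrightarrow> S v \<noteq> {}"
    and labels_pos: "v \<in> pverts D \<Longrightarrow> i \<in> S v \<Longrightarrow> i > 0"
    and weight_nonneg: "e \<in> parcs D \<Longrightarrow> w e \<ge> 0"
    and offset_pos: "e \<in> parcs D \<Longrightarrow> off e > 0"
    and satisfiable: "(u, v) \<in> parcs D \<Longrightarrow> Min (S u) + off (u, v) \<le> Max (S v)"

definition satisfies :: "('v \<times> 'v \<Rightarrow> nat) \<Rightarrow> ('v \<Rightarrow> nat) \<Rightarrow> 'v \<times> 'v \<Rightarrow> bool" where
  "satisfies off l e \<longleftrightarrow> l (fst e) + off e \<le> l (snd e)"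

definition all_labels :: "'v pair_pre_digraph \<Rightarrow> ('v \<Rightarrow> nat set) \<Rightarrow> nat set" where
  "all_labels D S = (\<Union>v\<in>pverts D. S v)"

definition lp_feasible ::
  "'v pair_pre_digraph \<Rightarrow> ('v \<Rightarrow> nat set) \<Rightarrow>
    ('v \<Rightarrow> nat \<Rightarrow> real) \<Rightarrow> ('v \<times> 'v \<Rightarrow> nat \<Rightarrow> nat \<Rightarrow> real) \<Rightarrow> bool" where
  "lp_feasible D S x y \<longleftrightarrow>
    (\<forall>v\<in>pverts D.
      (\<forall>i\<in>all_labels D S. x v i \<ge> 0) \<and>
      (\<forall>i\<in>all_labels D S - S v. x v i = 0) \<and>
      (\<Sum>i\<in>all_labels D S. x v i) = 1) \<and>
    (\<forall>(u, v)\<in>parcs D.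
      (\<forall>i\<in>all_labels D S. \<forall>j\<in>all_labels D S. y (u, v) i j \<ge> 0) \<and>
      (\<forall>i\<in>all_labels D S. (\<Sum>j\<in>all_labels D S. y (u, v) i j) = x u i) \<and>
      (\<forall>j\<in>all_labels D S. (\<Sum>i\<in>all_labels D S. y (u, v) i j) = x v j))"

definition lp_edge_value ::
  "('v \<Rightarrow> nat set) \<Rightarrow> ('v \<times> 'v \<Rightarrow> nat) \<Rightarrow>
    ('v \<times> 'v \<Rightarrow> nat \<Rightarrow> nat \<Rightarrow> real) \<Rightarrow> 'v \<times> 'v \<Rightarrow> real" where
  "lp_edge_value S off y e =
    (\<Sum>(i, j)\<in>{(i, j). i \<in> S (fst e) \<and> j \<in> S (snd e) \<and> i + off e \<le> j}. y e i j)"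

definition lp_objective ::
  "'v pair_pre_digraph \<Rightarrow> ('v \<Rightarrow> nat set) \<Rightarrow> ('v \<times> 'v \<Rightarrow> real) \<Rightarrow> ('v \<times> 'v \<Rightarrow> nat) \<Rightarrow>
    ('v \<times> 'v \<Rightarrow> nat \<Rightarrow> nat \<Rightarrow> real) \<Rightarrow> real" where
  "lp_objective D S w off y = (\<Sum>e\<in>parcs D. w e * lp_edge_value S off y e)"

definition lp_optimal ::
  "'v pair_pre_digraph \<Rightarrow> ('v \<Rightarrow> nat set) \<Rightarrow> ('v \<times> 'v \<Rightarrow> real) \<Rightarrow> ('v \<times> 'v \<Rightarrow> nat) \<Rightarrow>
    ('v \<Rightarrow> nat \<Rightarrow> real) \<Rightarrow> ('v \<times> 'v \<Rightarrow> nat \<Rightarrow> nat \<Rightarrow> real) \<Rightarrow> bool" where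
  "lp_optimal D S w off x y \<longleftrightarrow>
    lp_feasible D S x y \<and>
    (\<forall>x' y'. lp_feasible D S x' y' \<longrightarrow> lp_objective D S w off y' \<le> lp_objective D S w off y)"

text \<open>
  The rounding follows the LP with probability 1/2 and picks the least and the greatest label
  with probability 1/4 each.  When these coincide the label is deterministic; reading
  "\<open>1/4 + x/2\<close> for \<open>i \<in> {min, max}\<close>" verbatim would give total mass 3/4 there.
\<close>

definition label_prob :: "('v \<Rightarrow> nat set) \<Rightarrow> ('v \<Rightarrow> nat \<Rightarrow> real) \<Rightarrow> 'v \<Rightarrow> nat \<Rightarrow> real" where
  "label_prob S x v i =
    (if Min (S v) = Max (S v) then 1
     else if i \<in> {Min (S v), Max (S v)} then 1/4 + x v i / 2
     else x v i / 2)"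

text \<open>
  The probabilities are prescribed on \<open>S v\<close> only; they sum to 1 there (see below), so the random
  label lies in \<open>S v\<close> almost surely.
\<close>

definition randomized_labeling ::
  "'v pair_pre_digraph \<Rightarrow> ('v \<Rightarrow> nat set) \<Rightarrow> ('v \<Rightarrow> nat \<Rightarrow> real) \<Rightarrow>
    'w measure \<Rightarrow> ('v \<Rightarrow> 'w \<Rightarrow> nat) \<Rightarrow> bool" where
  "randomized_labeling D S x M lab \<longleftrightarrow>
    prob_space M \<and>
    prob_space.indep_vars M (\<lambda>_. count_space UNIV) lab (pverts D) \<and>
    (\<forall>v\<in>pverts D. \<forall>i\<in>S v. \<P>(\<omega> in M. lab v \<omega> = i) = label_prob S x v i)"

lemma (in offset_rmas) sum_label_prob:
  assumes "lp_feasible D S x y" and v: "v \<in> pverts D"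
  shows "(\<Sum>i\<in>S v. label_prob S x v i) = 1"
proof -
  have fin: "finite (S v)" and ne: "S v \<noteq> {}"
    using v finite_labels labels_nonempty by auto
  have finL: "finite (all_labels D S)"
    unfolding all_labels_def using pair_finite_verts finite_labels by auto
  have sub: "S v \<subseteq> all_labels D S" using v by (auto simp: all_labels_def)
  have "(\<Sum>i\<in>S v. x v i) = (\<Sum>i\<in>all_labels D S. x v i)"
    using assms by (intro sum.mono_neutral_left finL sub) (auto simp: lp_feasible_def)
  then have x1: "(\<Sum>i\<in>S v. x v i) = 1"
    using assms by (auto simp: lp_feasible_def)
  show ?thesis
  proof (cases "Min (S v) = Max (S v)")
    case True
    have "i = Min (S v)" if "i \<in> S v" for i
      using True Min_le[OF fin that] Max_ge[OF fin that] by simp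
    then have "S v = {Min (S v)}" using ne by auto
    then have "card (S v) = 1" by (metis is_singletonI is_singleton_altdef)
    then show ?thesis using True by (simp add: label_prob_def)
  next
    case False
    have "(\<Sum>i\<in>S v. label_prob S x v i) =
      (\<Sum>i\<in>S v. (if i = Min (S v) then 1/4 else 0) + (if i = Max (S v) then 1/4 else 0) + x v i / 2)"
      using False by (intro sum.cong) (auto simp: label_prob_def)
    also have "\<dots> = 1"
      using fin ne x1 by (simp add: sum.distrib sum.delta flip: sum_divide_distrib)
    finally show ?thesis .
  qed
qed

end

theory Submission
  imports Defs
begin

text \<open>
  Every label distribution is the mixture of the LP marginal (weight 1/2) and of the point masses at
  the least and the greatest label (weight 1/4 each).  Let \<open>z\<close> be the LP value of the edge
  \<open>(u, v)\<close>.  The pair (least, greatest) contributes 1/16, and the pairs (least, LP) and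
  (LP, greatest) contribute at least \<open>z/8\<close> each.  The pair (LP, LP) contributes at least
  \<open>z\<^sup>2/8\<close>: if \<open>(i, j)\<close> and \<open>(i', j')\<close> both satisfy the edge, then so does \<open>(i, j')\<close> or
  \<open>(i', j)\<close>, according to which of \<open>i\<close>, \<open>i'\<close> is smaller.  Finally
  \<open>1/16 + z\<^sup>2/8 \<ge> z/(4 sqrt 2)\<close> by AM-GM.
\<close>

section \<open>A deterministic inequality for products of two rounded marginals\<close>

lemma sum_crossed_pairs_ge:
  fixes g :: "nat \<times> nat \<Rightarrow> real" and k :: nat
  assumes nonneg: "\<And>p. p \<in> P \<Longrightarrow> g p \<ge> 0"
    and supp: "\<And>p. p \<in> P \<Longrightarrow> g p \<noteq> 0 \<Longrightarrow> fst p + k \<le> snd p"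
  shows "(\<Sum>p\<in>P. g p)\<^sup>2 \<le> 2 * (\<Sum>p\<in>P. \<Sum>q\<in>P. of_bool (fst p + k \<le> snd q) * (g p * g q))"
proof -
  let ?c = "\<lambda>p q. of_bool (fst p + k \<le> snd q) :: real"
  have "(\<Sum>p\<in>P. g p)\<^sup>2 = (\<Sum>p\<in>P. \<Sum>q\<in>P. g p * g q)"
    by (simp add: power2_eq_square sum_product)
  \<comment> \<open>Each product is charged to both orientations of the pair; the two resulting
    double sums agree after swapping \<open>p\<close> and \<open>q\<close>, which is the origin of
    the factor 2.\<close>
  also have "\<dots> \<le> (\<Sum>p\<in>P. \<Sum>q\<in>P. ?c p q * (g p * g q) + ?c q p * (g q * g p))"
  proof (intro sum_mono)
    fix p q assume pq: "p \<in> P" "q \<in> P"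
    show "g p * g q \<le> ?c p q * (g p * g q) + ?c q p * (g q * g p)"
    proof (cases "g p = 0 \<or> g q = 0")
      case False
      then have "fst p + k \<le> snd p" "fst q + k \<le> snd q" using supp pq by auto
      \<comment> \<open>If both crossed inequalities failed, adding them would contradict the sum of
        the two uncrossed ones.\<close>
      then have "fst p + k \<le> snd q \<or> fst q + k \<le> snd p" by linarith
      moreover have "g p * g q \<ge> 0" using nonneg pq by simp
      ultimately show ?thesis by (auto simp: of_bool_def mult.commute)
    qed auto
  qed
  also have "\<dots> = (\<Sum>p\<in>P. \<Sum>q\<in>P. ?c p q * (g p * g q)) + (\<Sum>p\<in>P. \<Sum>q\<in>P. ?c q p * (g q * g p))"
    by (simp add: sum.distrib)
  also have "(\<Sum>p\<in>P. \<Sum>q\<in>P. ?c q p * (g q * g p)) = (\<Sum>p\<in>P. \<Sum>q\<in>P. ?c p q * (g p * g q))"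
    by (rule sum.swap)
  finally show ?thesis by simp
qed

lemma sum_of_bool_mult_eq:
  fixes f :: "'a \<Rightarrow> real"
  assumes "finite A" "a \<in> A"
  shows "(\<Sum>i\<in>A. of_bool (i = a) * f i) = f a"
  using assms by (simp add: of_bool_def if_distrib[of "\<lambda>t. t * _"] sum.delta cong: if_cong)

text \<open>Here \<open>p\<close> and \<open>q\<close> are only bounded below: \<open>g\<close> will
  be the LP solution cut down to satisfying pairs, so its marginals may be smaller than those of the
  LP.\<close>

lemma sum_product_rounding_ge:
  fixes g :: "nat \<Rightarrow> nat \<Rightarrow> real" and p q :: "nat \<Rightarrow> real" and a b k :: nat
  assumes fin: "finite A" "finite B"
    and a: "a \<in> A" "\<And>i. i \<in> A \<Longrightarrow> a \<le> i"
    and b: "b \<in> B" "\<And>j. j \<in> B \<Longrightarrow> j \<le> b"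
    and ab: "a + k \<le> b"
    and nonneg: "\<And>i j. i \<in> A \<Longrightarrow> j \<in> B \<Longrightarrow> g i j \<ge> 0"
    and supp: "\<And>i j. i \<in> A \<Longrightarrow> j \<in> B \<Longrightarrow> g i j \<noteq> 0 \<Longrightarrow> i + k \<le> j"
    and p: "\<And>i. i \<in> A \<Longrightarrow> (\<Sum>j\<in>B. g i j) / 2 + of_bool (i = a) / 4 \<le> p i"
    and q: "\<And>j. j \<in> B \<Longrightarrow> (\<Sum>i\<in>A. g i j) / 2 + of_bool (j = b) / 4 \<le> q j"
    and z: "z = (\<Sum>i\<in>A. \<Sum>j\<in>B. g i j)"
  shows "1/16 + z / 4 + z\<^sup>2 / 8 \<le> (\<Sum>i\<in>A. \<Sum>j\<in>B. of_bool (i + k \<le> j) * (p i * q j))"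
proof -
  let ?c = "\<lambda>i j. of_bool (i + k \<le> j) :: real"
  define r where "r i = (\<Sum>j\<in>B. g i j)" for i
  define s where "s j = (\<Sum>i\<in>A. g i j)" for j
  have r0: "r i \<ge> 0" if "i \<in> A" for i
    unfolding r_def using that nonneg by (intro sum_nonneg) auto
  have s0: "s j \<ge> 0" if "j \<in> B" for j
    unfolding s_def using that nonneg by (intro sum_nonneg) auto
  have zr: "z = (\<Sum>i\<in>A. r i)" by (simp add: z r_def)
  have zs: "z = (\<Sum>j\<in>B. s j)" unfolding z s_def by (rule sum.swap)
  \<comment> \<open>If \<open>i\<close> is incompatible even with the greatest head label
    \<open>b\<close>, its whole row of \<open>g\<close> vanishes. So pairing the tail marginal with
    \<open>b\<close> loses no mass.\<close>
  have r_supp: "?c i b * r i = r i" if "i \<in> A" for i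
  proof (cases "i + k \<le> b")
    case False
    then have "g i j = 0" if "j \<in> B" for j
      using supp[of i j] b(2)[of j] that \<open>i \<in> A\<close> by fastforce
    then show ?thesis by (simp add: r_def)
  qed simp
  have s_supp: "?c a j * s j = s j" if "j \<in> B" for j
  proof (cases "a + k \<le> j")
    case False
    then have "g i j = 0" if "i \<in> A" for i
      using supp[of i j] a(2)[of i] that \<open>j \<in> B\<close> by fastforce
    then show ?thesis by (simp add: s_def)
  qed simp
  \<comment> \<open>The crossed condition involves only the first label of one pair and the second
    label of the other. Summing out the two remaining labels leaves the product of the
    marginals.\<close>
  have rs: "z\<^sup>2 \<le> 2 * (\<Sum>i\<in>A. \<Sum>j\<in>B. ?c i j * (r i * s j))"
  proof -
    have "z\<^sup>2 = (\<Sum>t\<in>A \<times> B. case_prod g t)\<^sup>2"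
      by (simp add: z sum.cartesian_product)
    also have "\<dots> \<le> 2 * (\<Sum>t\<in>A \<times> B. \<Sum>t'\<in>A \<times> B.
        of_bool (fst t + k \<le> snd t') * (case_prod g t * case_prod g t'))"
      using nonneg supp by (intro sum_crossed_pairs_ge) auto
    also have "(\<Sum>t\<in>A \<times> B. \<Sum>t'\<in>A \<times> B.
        of_bool (fst t + k \<le> snd t') * (case_prod g t * case_prod g t'))
      = (\<Sum>i\<in>A. \<Sum>j'\<in>B. \<Sum>i'\<in>A. \<Sum>j\<in>B. ?c i j * (g i j' * g i' j))"
      by (simp add: sum.cartesian_product' case_prod_unfold)
    also have "\<dots> = (\<Sum>i\<in>A. \<Sum>j\<in>B. ?c i j * (r i * s j))"
    proof (rule sum.cong[OF refl])
      fix i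
      have "(\<Sum>j'\<in>B. \<Sum>i'\<in>A. \<Sum>j\<in>B. ?c i j * (g i j' * g i' j))
        = (\<Sum>j'\<in>B. \<Sum>j\<in>B. \<Sum>i'\<in>A. ?c i j * (g i j' * g i' j))"
        by (intro sum.cong refl sum.swap)
      also have "\<dots> = (\<Sum>j\<in>B. \<Sum>j'\<in>B. \<Sum>i'\<in>A. ?c i j * (g i j' * g i' j))"
        by (rule sum.swap)
      also have "\<dots> = (\<Sum>j\<in>B. ?c i j * (r i * s j))"
        unfolding r_def s_def sum_product by (simp add: sum_distrib_left)
      finally show "(\<Sum>j'\<in>B. \<Sum>i'\<in>A. \<Sum>j\<in>B. ?c i j * (g i j' * g i' j))
        = (\<Sum>j\<in>B. ?c i j * (r i * s j))" .
    qed
    finally show ?thesis .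
  qed
  have "(\<Sum>i\<in>A. \<Sum>j\<in>B. of_bool (i = a) * (?c i j * s j))
      = (\<Sum>i\<in>A. of_bool (i = a) * (\<Sum>j\<in>B. ?c i j * s j))"
    by (simp only: sum_distrib_left)
  also have "\<dots> = z" using fin a by (simp only: sum_of_bool_mult_eq zs s_supp cong: sum.cong)
  finally have as: "(\<Sum>i\<in>A. \<Sum>j\<in>B. of_bool (i = a) * (?c i j * s j)) = z" .
  have rb: "(\<Sum>i\<in>A. \<Sum>j\<in>B. of_bool (j = b) * (?c i j * r i)) = z"
    using fin b by (simp only: sum_of_bool_mult_eq zr r_supp cong: sum.cong)
  have "(\<Sum>i\<in>A. \<Sum>j\<in>B. of_bool (i = a) * (of_bool (j = b) * ?c i j))
      = (\<Sum>i\<in>A. of_bool (i = a) * (\<Sum>j\<in>B. of_bool (j = b) * ?c i j))"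
    by (simp only: sum_distrib_left)
  also have "\<dots> = 1" using fin a b ab by (simp only: sum_of_bool_mult_eq) simp
  finally have ab1: "(\<Sum>i\<in>A. \<Sum>j\<in>B. of_bool (i = a) * (of_bool (j = b) * ?c i j)) = 1" .
  \<comment> \<open>The coefficients are the products of the mixture weights: 1/4 for an extreme
    label and 1/2 for a marginal. The last sum is at least half of \<open>z\<close> squared by
    \<open>rs\<close>.\<close>
  have "1/16 + z / 4 + z\<^sup>2 / 8 \<le>
      1/16 * (\<Sum>i\<in>A. \<Sum>j\<in>B. of_bool (i = a) * (of_bool (j = b) * ?c i j))
    + 1/8 * (\<Sum>i\<in>A. \<Sum>j\<in>B. of_bool (i = a) * (?c i j * s j))
    + 1/8 * (\<Sum>i\<in>A. \<Sum>j\<in>B. of_bool (j = b) * (?c i j * r i))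
    + 1/4 * (\<Sum>i\<in>A. \<Sum>j\<in>B. ?c i j * (r i * s j))"
    using rs unfolding as rb ab1 by simp
  also have "\<dots> = (\<Sum>i\<in>A. \<Sum>j\<in>B. ?c i j *
      ((r i / 2 + of_bool (i = a) / 4) * (s j / 2 + of_bool (j = b) / 4)))"
    unfolding sum_distrib_left sum.distrib[symmetric]
    by (intro sum.cong refl) (simp add: field_simps)
  also have "\<dots> \<le> (\<Sum>i\<in>A. \<Sum>j\<in>B. ?c i j * (p i * q j))"
  proof (intro sum_mono mult_left_mono)
    fix i j assume ij: "i \<in> A" "j \<in> B"
    show "(r i / 2 + of_bool (i = a) / 4) * (s j / 2 + of_bool (j = b) / 4) \<le> p i * q j"
      using p[OF ij(1)] q[OF ij(2)] r0[OF ij(1)] s0[OF ij(2)]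
      by (intro mult_mono) (auto simp: r_def s_def intro: order_trans[rotated])
  qed simp
  finally show ?thesis .
qed

text \<open>The term z/4 is common to both sides; the rest is a perfect square, which vanishes at z
  = 1/sqrt 2.\<close>

lemma am_gm_rounding_constant:
  fixes z :: real
  shows "1/4 * (1 + 1 / sqrt 2) * z \<le> 1/16 + z / 4 + z\<^sup>2 / 8"
proof -
  have "0 \<le> (1/4 - z / (2 * sqrt 2))\<^sup>2" by simp
  also have "\<dots> = 1/16 + z\<^sup>2 / 8 - 1/4 * (1 / sqrt 2) * z"
    by (simp add: power2_diff power_divide power_mult_distrib)
  finally show ?thesis by (simp add: algebra_simps)
qed

section \<open>LP marginals, independence, and the bound for one edge\<close>

context offset_rmas
begin

lemma finite_all_labels: "finite (all_labels D S)"
  unfolding all_labels_def using pair_finite_verts finite_labels by auto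

text \<open>This also covers a vertex with a single label: all LP mass sits there, and 1/2 + 1/4 +
  1/4 = 1.\<close>

lemma label_prob_eq_mixture:
  assumes feas: "lp_feasible D S x y" and v: "v \<in> pverts D" and i: "i \<in> S v"
  shows "label_prob S x v i =
    x v i / 2 + of_bool (i = Min (S v)) / 4 + of_bool (i = Max (S v)) / 4"
proof (cases "Min (S v) = Max (S v)")
  case True
  have "k = i" if "k \<in> S v" for k
    using True Min_le[OF finite_labels[OF v] that] Max_ge[OF finite_labels[OF v] that]
      Min_le[OF finite_labels[OF v] i] Max_ge[OF finite_labels[OF v] i] by linarith
  then have Sv: "S v = {i}" using i by blast
  have "x v i = (\<Sum>k\<in>all_labels D S. x v k)"
    using feas v i finite_all_labels Sv
    by (subst sum.mono_neutral_right[of _ "S v"]) (auto simp: lp_feasible_def all_labels_def)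
  also have "\<dots> = 1" using feas v by (auto simp: lp_feasible_def)
  finally show ?thesis by (simp add: label_prob_def Sv)
qed (auto simp: label_prob_def)

lemma lp_row_sum:
  assumes feas: "lp_feasible D S x y" and e: "(u, v) \<in> parcs D" and i: "i \<in> S u"
  shows "(\<Sum>j\<in>S v. y (u, v) i j) \<le> x u i"
proof -
  have uv: "u \<in> pverts D" "v \<in> pverts D" using e in_arcsD1 in_arcsD2 by auto
  then have "(\<Sum>j\<in>S v. y (u, v) i j) \<le> (\<Sum>j\<in>all_labels D S. y (u, v) i j)"
    using feas e i
    by (intro sum_mono2 finite_all_labels) (auto simp: lp_feasible_def all_labels_def)
  also have "\<dots> = x u i" using feas e i uv by (auto simp: lp_feasible_def all_labels_def)
  finally show ?thesis .
qed

lemma lp_column_sum: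
  assumes feas: "lp_feasible D S x y" and e: "(u, v) \<in> parcs D" and j: "j \<in> S v"
  shows "(\<Sum>i\<in>S u. y (u, v) i j) \<le> x v j"
proof -
  have uv: "u \<in> pverts D" "v \<in> pverts D" using e in_arcsD1 in_arcsD2 by auto
  then have "(\<Sum>i\<in>S u. y (u, v) i j) \<le> (\<Sum>i\<in>all_labels D S. y (u, v) i j)"
    using feas e j
    by (intro sum_mono2 finite_all_labels) (auto simp: lp_feasible_def all_labels_def)
  also have "\<dots> = x v j" using feas e j uv by (auto simp: lp_feasible_def all_labels_def)
  finally show ?thesis .
qed

text \<open>The events fixing both end labels are disjoint and have product probabilities. A lower
  bound avoids arguing about outcomes with labels outside \<open>S u\<close> or
  \<open>S v\<close>.\<close>

lemma prob_satisfies_ge: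
  assumes lab: "randomized_labeling D S x M lab" and e: "(u, v) \<in> parcs D"
  shows "(\<Sum>i\<in>S u. \<Sum>j\<in>S v.
      of_bool (i + off (u, v) \<le> j) * (label_prob S x u i * label_prob S x v j))
    \<le> \<P>(\<omega> in M. satisfies off (\<lambda>v. lab v \<omega>) (u, v))"
proof -
  interpret M: prob_space M using lab by (simp add: randomized_labeling_def)
  have uv: "u \<in> pverts D" "v \<in> pverts D" using e in_arcsD1 in_arcsD2 by auto
  \<comment> \<open>Independence of the two end labels requires two distinct vertices, so
    loop-freeness enters here.\<close>
  have "u \<noteq> v" using e no_loops by fastforce
  have indep: "M.indep_vars (\<lambda>_. count_space UNIV) lab (pverts D)"
    using lab by (simp add: randomized_labeling_def)
  have meas [measurable]: "lab u \<in> measurable M (count_space UNIV)"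
    "lab v \<in> measurable M (count_space UNIV)"
    using indep uv by (auto simp: M.indep_vars_def)
  define E where "E = (\<lambda>(i, j). {\<omega> \<in> space M. lab u \<omega> = i \<and> lab v \<omega> = j})"
  have prob_E: "M.prob (E (i, j)) = label_prob S x u i * label_prob S x v j"
    if "i \<in> S u" "j \<in> S v" for i j
  proof -
    let ?L = "\<lambda>t. if t = u then {i} else {j}"
    have "M.prob (E (i, j)) = M.prob (\<Inter>t\<in>{u, v}. lab t -` ?L t \<inter> space M)"
      using \<open>u \<noteq> v\<close> by (intro arg_cong[where f = M.prob]) (auto simp: E_def)
    also have "\<dots> = (\<Prod>t\<in>{u, v}. M.prob (lab t -` ?L t \<inter> space M))"
      using uv by (intro M.indep_varsD[OF indep]) auto
    also have "\<dots> = M.prob (lab u -` {i} \<inter> space M) * M.prob (lab v -` {j} \<inter> space M)"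
      using \<open>u \<noteq> v\<close> by simp
    also have "lab u -` {i} \<inter> space M = {\<omega> \<in> space M. lab u \<omega> = i}" by auto
    also have "lab v -` {j} \<inter> space M = {\<omega> \<in> space M. lab v \<omega> = j}" by auto
    finally show ?thesis using lab that uv by (simp add: randomized_labeling_def)
  qed
  define G where "G = {t \<in> S u \<times> S v. fst t + off (u, v) \<le> snd t}"
  have finG: "finite G" unfolding G_def using finite_labels uv by auto
  have "(\<Sum>i\<in>S u. \<Sum>j\<in>S v.
      of_bool (i + off (u, v) \<le> j) * (label_prob S x u i * label_prob S x v j))
    = (\<Sum>t\<in>S u \<times> S v. if fst t + off (u, v) \<le> snd t then M.prob (E t) else 0)"
    unfolding sum.cartesian_product by (intro sum.cong) (auto simp: prob_E)
  also have "\<dots> = (\<Sum>t\<in>G. M.prob (E t))"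
    unfolding G_def using finite_labels uv by (intro sum.inter_filter[symmetric]) auto
  also have "\<dots> = M.prob (\<Union>t\<in>G. E t)"
    using finG
    by (intro M.finite_measure_finite_Union[symmetric]) (auto simp: E_def disjoint_family_on_def)
  also have "\<dots> \<le> \<P>(\<omega> in M. lab u \<omega> + off (u, v) \<le> lab v \<omega>)"
  proof (rule M.finite_measure_mono)
    \<comment> \<open>Measurability is shown for the real-valued comparison and transferred back,
      since the cast preserves sums and order.\<close>
    have "{\<omega> \<in> space M. real (lab u \<omega>) + real (off (u, v)) \<le> real (lab v \<omega>)} \<in> M.events"
      by measurable
    then show "{\<omega> \<in> space M. lab u \<omega> + off (u, v) \<le> lab v \<omega>} \<in> M.events"
      by (simp flip: of_nat_add)
  qed (auto simp: E_def G_def)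
  also have "\<dots> = \<P>(\<omega> in M. satisfies off (\<lambda>v. lab v \<omega>) (u, v))"
    by (simp add: satisfies_def)
  finally show ?thesis .
qed

lemma prob_satisfies_ge_lp_edge_value:
  assumes feas: "lp_feasible D S x y" and lab: "randomized_labeling D S x M lab"
    and e: "(u, v) \<in> parcs D"
  shows "1/4 * (1 + 1 / sqrt 2) * lp_edge_value S off y (u, v)
    \<le> \<P>(\<omega> in M. satisfies off (\<lambda>v. lab v \<omega>) (u, v))"
proof -
  let ?z = "lp_edge_value S off y (u, v)"
  have uv: "u \<in> pverts D" "v \<in> pverts D" using e in_arcsD1 in_arcsD2 by auto
  note fin = finite_labels[OF uv(1)] finite_labels[OF uv(2)]
  note ne = labels_nonempty[OF uv(1)] labels_nonempty[OF uv(2)]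
  \<comment> \<open>Zeroing the violating pairs makes the total mass equal to the edge
    value.\<close>
  define g where "g i j = (if i + off (u, v) \<le> j then y (u, v) i j else 0)" for i j
  have y0: "y (u, v) i j \<ge> 0" if "i \<in> S u" "j \<in> S v" for i j
    using feas e that uv by (auto simp: lp_feasible_def all_labels_def)
  have z: "?z = (\<Sum>i\<in>S u. \<Sum>j\<in>S v. g i j)"
  proof -
    have "?z = (\<Sum>t\<in>{t \<in> S u \<times> S v. fst t + off (u, v) \<le> snd t}. y (u, v) (fst t) (snd t))"
      unfolding lp_edge_value_def by (intro sum.cong) auto
    also have "\<dots> = (\<Sum>t\<in>S u \<times> S v. g (fst t) (snd t))"
      unfolding g_def using fin by (intro sum.inter_filter) auto
    finally show ?thesis by (simp add: sum.cartesian_product case_prod_unfold)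
  qed
  have p: "(\<Sum>j\<in>S v. g i j) / 2 + of_bool (i = Min (S u)) / 4 \<le> label_prob S x u i"
    if "i \<in> S u" for i
  proof -
    have "(\<Sum>j\<in>S v. g i j) \<le> (\<Sum>j\<in>S v. y (u, v) i j)"
      using y0 that by (intro sum_mono) (auto simp: g_def)
    also have "\<dots> \<le> x u i" using lp_row_sum[OF feas e that] .
    finally have "(\<Sum>j\<in>S v. g i j) / 2 \<le> x u i / 2" by simp
    \<comment> \<open>The extra mass on the greatest tail label is dropped; symmetrically, the head
      will give up that on its least label.\<close>
    moreover have "(0::real) \<le> of_bool (i = Max (S u))" by simp
    ultimately show ?thesis unfolding label_prob_eq_mixture[OF feas uv(1) that] by linarith
  qed
  have q: "(\<Sum>i\<in>S u. g i j) / 2 + of_bool (j = Max (S v)) / 4 \<le> label_prob S x v j"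
    if "j \<in> S v" for j
  proof -
    have "(\<Sum>i\<in>S u. g i j) \<le> (\<Sum>i\<in>S u. y (u, v) i j)"
      using y0 that by (intro sum_mono) (auto simp: g_def)
    also have "\<dots> \<le> x v j" using lp_column_sum[OF feas e that] .
    finally have "(\<Sum>i\<in>S u. g i j) / 2 \<le> x v j / 2" by simp
    moreover have "(0::real) \<le> of_bool (j = Min (S v))" by simp
    ultimately show ?thesis unfolding label_prob_eq_mixture[OF feas uv(2) that] by linarith
  qed
  have "1/4 * (1 + 1 / sqrt 2) * ?z \<le> 1/16 + ?z / 4 + ?z\<^sup>2 / 8"
    by (rule am_gm_rounding_constant)
  also have "\<dots> \<le> (\<Sum>i\<in>S u. \<Sum>j\<in>S v.
      of_bool (i + off (u, v) \<le> j) * (label_prob S x u i * label_prob S x v j))"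
  \<comment> \<open>The assumption \<open>satisfiable\<close> makes the pair (least, greatest)
    satisfy the edge, which yields the constant 1/16.\<close>
  proof (rule sum_product_rounding_ge[OF fin Min_in[OF fin(1) ne(1)] Min_le[OF fin(1)]
        Max_in[OF fin(2) ne(2)] Max_ge[OF fin(2)] satisfiable[OF e] _ _ p q z])
    fix i j assume "i \<in> S u" "j \<in> S v"
    then show "0 \<le> g i j" using y0 by (simp add: g_def)
    show "i + off (u, v) \<le> j" if "g i j \<noteq> 0" using that by (simp add: g_def split: if_splits)
  qed
  also have "\<dots> \<le> \<P>(\<omega> in M. satisfies off (\<lambda>v. lab v \<omega>) (u, v))"
    by (rule prob_satisfies_ge[OF lab e])
  finally show ?thesis .
qed

end

theorem theorem6:
  fixes D :: "'v pair_pre_digraph"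
    and S :: "'v \<Rightarrow> nat set"
    and w :: "'v \<times> 'v \<Rightarrow> real"
    and off :: "'v \<times> 'v \<Rightarrow> nat"
    and x :: "'v \<Rightarrow> nat \<Rightarrow> real"
    and y :: "'v \<times> 'v \<Rightarrow> nat \<Rightarrow> nat \<Rightarrow> real"
    and M :: "'w measure"
    and lab :: "'v \<Rightarrow> 'w \<Rightarrow> nat"
  assumes "offset_rmas D S w off"
    and "lp_optimal D S w off x y"
    and "randomized_labeling D S x M lab"
    and "e \<in> parcs D"
  shows "\<P>(\<omega> in M. satisfies off (\<lambda>v. lab v \<omega>) e)
    \<ge> 1/4 * (1 + 1 / sqrt 2) * lp_edge_value S off y e"
proof (cases e)
  case (Pair u v)
  have "lp_feasible D S x y" using assms(2) by (simp add: lp_optimal_def)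
  then show ?thesis
    unfolding Pair
    by (rule offset_rmas.prob_satisfies_ge_lp_edge_value[OF assms(1) _ assms(3)])
      (use assms(4) Pair in blast)
qed

end
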